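(* Let $G$ be a finite transitive permutation group on a set $\Omega$, let $\alpha\in\Omega$ and let $G_\alpha$ be the stabilizer in $G$ of the point $\alpha$. If $\mathbf{I}_\Omega(G)>\frac{5}{6}$, then $\mathbf{I}_\Omega(G)=1$, that is, each suborbit of $G$ (each orbit of $G_\alpha$ on $\Omega$) has cardinality at most $2$.
   Context: For a finite transitive permutation group $G$ on $\Omega$ and $\alpha\in\Omega$, the suborbits of $G$ are the orbits of $G_\alpha$ on $\Omega$, and $$\mathbf{I}_\Omega(G):=\frac{|\{\omega\in\Omega\mid \omega\text{ lies in a }G_\alpha\text{-orbit of cardinality at most two}\}|}{|\Omega|}.$$ As $G$ is transitive on $\Omega$, this value does not depend on the choice of $\alpha$. *)

theory Defs
  imports Complex_Main "HOL-Algebra.Group_Action"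
begin

text \<open>
  A permutation group on \<open>\<Omega>\<close> is a set \<open>G\<close> of permutations with \<open>subgroup G (BijGroup \<Omega>)\<close>. The
  library's notions for actions apply to the following structure, with each permutation acting
  as itself.
\<close>

abbreviation perm_group :: "'a set \<Rightarrow> ('a \<Rightarrow> 'a) set \<Rightarrow> ('a \<Rightarrow> 'a) monoid"
  where "perm_group \<Omega> G \<equiv> (BijGroup \<Omega>)\<lparr>carrier := G\<rparr>"

abbreviation point_stabilizer :: "'a set \<Rightarrow> ('a \<Rightarrow> 'a) set \<Rightarrow> 'a \<Rightarrow> ('a \<Rightarrow> 'a) set"
  where "point_stabilizer \<Omega> G \<alpha> \<equiv> stabilizer (perm_group \<Omega> G) (\<lambda>g. g) \<alpha>"

definition suborbits :: "'a set \<Rightarrow> ('a \<Rightarrow> 'a) set \<Rightarrow> 'a \<Rightarrow> 'a set set"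
  where "suborbits \<Omega> G \<alpha> = orbits (perm_group \<Omega> (point_stabilizer \<Omega> G \<alpha>)) \<Omega> (\<lambda>g. g)"

text \<open>
  The base point is an explicit argument; for transitive \<open>G\<close> the value does not depend on it.
\<close>

definition small_suborbit_ratio :: "'a set \<Rightarrow> ('a \<Rightarrow> 'a) set \<Rightarrow> 'a \<Rightarrow> real"  ("\<^bold>I")
  where "\<^bold>I \<Omega> G \<alpha> =
    real (card {\<omega> \<in> \<Omega>. \<exists>\<Delta> \<in> suborbits \<Omega> G \<alpha>. \<omega> \<in> \<Delta> \<and> card \<Delta> \<le> 2}) / real (card \<Omega>)"

end

theory Submission
  imports Defs
begin

text \<open>
  Write \<open>S x\<close> for the stabilizer of \<open>x\<close>, and call \<open>y\<close> far from \<open>x\<close> if \<open>S x \<inter> S y\<close> has index more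
  than two in \<open>S x\<close>, that is, if the suborbit of \<open>y\<close> relative to \<open>x\<close> has more than two points. All
  stabilizers have the same order \<open>h\<close>, so being far is a symmetric relation; it is invariant under
  \<open>G\<close>, so every point is far from the same number \<open>D\<close> of points, and the hypothesis says that
  \<open>6 * D < n\<close>, where \<open>n\<close> is the number of points. The claim is that \<open>D = 0\<close>. From
  here on the argument is about a family of subgroups of equal order with trivial total
  intersection, and the action is left behind.

  Suppose that \<open>x\<close> and \<open>y\<close> are far from each other. If \<open>z\<close> is far from neither of them, then
  \<open>S z \<inter> S x\<close> and \<open>S z \<inter> S y\<close> have index at most two in \<open>S z\<close>, so their intersection has order at
  least \<open>h / 4\<close>. It lies in \<open>S x \<inter> S y\<close>, which has order less than \<open>h / 2\<close>, so by Lagrange the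
  two are equal. Hence \<open>S x \<inter> S y\<close> has order exactly \<open>h / 4\<close> and is contained in \<open>S z\<close>
  (\<open>far_Int_via_near_both\<close>). Thus \<open>S x \<inter> S y\<close> lies in \<open>S z\<close> for more than two thirds of all \<open>z\<close>.
  Given any point \<open>d\<close>, fewer than half of the points \<open>c\<close> violate \<open>S x \<inter> S y \<subseteq> S c\<close> or are far from
  \<open>d\<close>, so a double count yields a far pair \<open>c\<close>, \<open>e\<close> among the others. Comparing orders,
  \<open>S x \<inter> S y = S c \<inter> S e \<subseteq> S d\<close>. As \<open>d\<close> is arbitrary, \<open>S x \<inter> S y\<close> is trivial and \<open>h = 4\<close>
  (\<open>far_Int_trivial\<close>, \<open>far_order_four\<close>).

  Fix such \<open>x\<close> and \<open>y\<close>, and let \<open>T\<close> be the set of points that are far from neither; it has more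
  than \<open>4 * D\<close> elements. For \<open>z\<close> in \<open>T\<close> the group \<open>S z\<close> is the product of its traces
  \<open>S z \<inter> S x\<close> and \<open>S z \<inter> S y\<close>, both of order two. So \<open>S z\<close> occupies a cell of a grid whose rows
  and columns are the subgroups of order two of \<open>S x\<close> and of \<open>S y\<close>, at most three of each. A cell
  contains at most \<open>D\<close> points, since a point that is far from one of them is far from all. Points
  in different rows and different columns are far from each other (\<open>distinct_traces_far\<close>). Hence
  all points of \<open>T\<close>, except at most \<open>D\<close> that are far from \<open>z\<close> and at most \<open>D\<close> in the cell of \<open>z\<close>,
  lie in the rest of the row or of the column of \<open>z\<close>. These two rests together have more than
  \<open>2 * D\<close> points. If both contain points, then each has at most \<open>D\<close>, being far from a point of the
  other; if one is empty, then the other consists of at most two cells, so it has at most \<open>2 * D\<close>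
  points. Either way this is a contradiction.
\<close>

section \<open>Products of two subgroups\<close>

context group
begin

text \<open>
  The map \<open>(u, v) \<mapsto> inv u \<otimes> v\<close> into \<open>W\<close> has fibres of size at most \<open>card (U \<inter> V)\<close>: if two pairs
  have the same image, the quotient of their first components is also that of the second ones.
\<close>
lemma card_mult_le_card_Int:
  assumes U: "subgroup U G" and V: "subgroup V G" and W: "subgroup W G"
    and "U \<subseteq> W" "V \<subseteq> W" "finite W"
  shows "card U * card V \<le> card W * card (U \<inter> V)"
proof -
  interpret U: subgroup U G by (fact U)
  interpret V: subgroup V G by (fact V)
  interpret W: subgroup W G by (fact W)
  have fin: "finite U" "finite V"
    using assms finite_subset by blast+
  let ?f = "\<lambda>(u, v). inv u \<otimes> v"
  have fibre: "card {p \<in> U \<times> V. ?f p = w} \<le> card (U \<inter> V)" for w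
  proof (cases "{p \<in> U \<times> V. ?f p = w} = {}")
    case True
    then show ?thesis by (simp only: card.empty)
  next
    case False
    then obtain u0 v0 where p0: "u0 \<in> U" "v0 \<in> V" "inv u0 \<otimes> v0 = w"
      by auto
    have eq: "u \<otimes> inv u0 = v \<otimes> inv v0"
      if "u \<in> U" "v \<in> V" "inv u \<otimes> v = w" for u v
    proof -
      have "inv u \<otimes> v = inv u0 \<otimes> v0"
        using that p0 by simp
      then have "v = u \<otimes> inv u0 \<otimes> v0"
        using that p0 by (metis U.mem_carrier V.mem_carrier inv_closed inv_solve_left m_assoc m_closed)
      then show ?thesis
        using that p0 by (metis U.mem_carrier V.mem_carrier inv_closed inv_solve_right m_closed)
    qed
    show ?thesis
    proof (rule card_inj_on_le[where f = "\<lambda>(u, v). u \<otimes> inv u0"])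
      show "inj_on (\<lambda>(u, v). u \<otimes> inv u0) {p \<in> U \<times> V. ?f p = w}"
      proof (rule inj_onI, clarsimp)
        fix u v u' v'
        assume a: "u \<in> U" "v \<in> V" "w = inv u \<otimes> v" "u' \<in> U" "v' \<in> V"
          "inv u' \<otimes> v' = inv u \<otimes> v" "u \<otimes> inv u0 = u' \<otimes> inv u0"
        then have "u = u'"
          using p0 by (meson U.mem_carrier inv_closed right_cancel)
        then show "u = u' \<and> v = v'"
          using a by simp
      qed
      show "(\<lambda>(u, v). u \<otimes> inv u0) ` {p \<in> U \<times> V. ?f p = w} \<subseteq> U \<inter> V"
        using eq p0 by auto
      show "finite (U \<inter> V)" using fin by simp
    qed
  qed
  have "?f ` (U \<times> V) \<subseteq> W"
    using assms by auto
  then have "(\<Sum>w\<in>W. card {p \<in> U \<times> V. ?f p = w}) = card (U \<times> V)"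
    using sum.group[of "U \<times> V" W ?f "\<lambda>_. 1::nat"] fin \<open>finite W\<close> by simp
  moreover have "(\<Sum>w\<in>W. card {p \<in> U \<times> V. ?f p = w}) \<le> card W * card (U \<inter> V)"
    using sum_bounded_above[of W "\<lambda>w. card {p \<in> U \<times> V. ?f p = w}"] fibre by simp
  ultimately show ?thesis
    by (simp add: card_cartesian_product)
qed

lemma subgroup_card_dvd:
  assumes U: "subgroup U G" and W: "subgroup W G" and "U \<subseteq> W"
  shows "card U dvd card W"
proof -
  interpret W: group "G\<lparr>carrier := W\<rparr>"
    using W by (rule subgroup_imp_group)
  have "subgroup U (G\<lparr>carrier := W\<rparr>)"
    using assms by (simp add: subgroup_incl)
  from W.lagrange[OF this] have "card (rcosets\<^bsub>G\<lparr>carrier := W\<rparr>\<^esub> U) * card U = card W"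
    by (simp add: order_def)
  then show ?thesis
    by (metis dvd_triv_right)
qed

lemma factorization_unique:
  assumes U: "subgroup U G" and V: "subgroup V G" and "U \<inter> V = {\<one>}"
    and "u \<in> U" "u' \<in> U" "v \<in> V" "v' \<in> V" "u \<otimes> v = u' \<otimes> v'"
  shows "u = u'" "v = v'"
proof -
  interpret U: subgroup U G by (fact U)
  interpret V: subgroup V G by (fact V)
  have carr: "u \<in> carrier G" "u' \<in> carrier G" "v \<in> carrier G" "v' \<in> carrier G"
    using assms(4-7) by auto
  have "inv u' \<otimes> (u \<otimes> v) = v'"
    unfolding assms(8) using carr by (simp add: m_assoc[symmetric])
  then have "inv u' \<otimes> u = v' \<otimes> inv v"
    using carr inv_solve_right[of "inv u' \<otimes> u" v' v] by (simp add: m_assoc)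
  moreover have "inv u' \<otimes> u \<in> U" "v' \<otimes> inv v \<in> V"
    using assms(4-7) by auto
  ultimately have one: "inv u' \<otimes> u = \<one>" "v' \<otimes> inv v = \<one>"
    using assms(3) by auto
  show "u = u'"
    by (rule inj_onD[OF inv_inj]) (use inv_equality[OF one(1)] carr in simp_all)
  show "v = v'"
    using inv_equality[OF one(2)] carr by simp
qed

lemma complement_factorization:
  assumes U: "subgroup U G" and V: "subgroup V G" and W: "subgroup W G"
    and "U \<subseteq> W" "V \<subseteq> W" "finite W" "U \<inter> V = {\<one>}" "card U * card V = card W" "g \<in> W"
  obtains u v where "u \<in> U" "v \<in> V" "g = u \<otimes> v"
proof -
  interpret W: subgroup W G by (fact W)
  let ?f = "\<lambda>(u, v). u \<otimes> v"
  have "inj_on ?f (U \<times> V)"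
    using factorization_unique[OF U V \<open>U \<inter> V = {\<one>}\<close>]
    by (fast intro!: inj_onI)
  then have "card (?f ` (U \<times> V)) = card W"
    using assms by (simp add: card_image card_cartesian_product)
  moreover have "?f ` (U \<times> V) \<subseteq> W"
    using assms by auto
  ultimately have "?f ` (U \<times> V) = W"
    using \<open>finite W\<close> by (simp add: card_subset_eq)
  then show ?thesis
    using \<open>g \<in> W\<close> that by auto
qed

end


section \<open>Subgroups of equal order, most pairs of which meet in index at most two\<close>

text \<open>
  Point stabilizers of a transitive permutation group are the intended instance. That all members
  have the same order makes the relation in \<open>regular\<close> symmetric, and transitivity makes it regular;
  \<open>faithful\<close> is the faithfulness of the action.
\<close>

locale mostly_close_subgroups = group G for G (structure) +
  fixes \<Omega> :: "'b set" and S :: "'b \<Rightarrow> 'a set" and h D :: nat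
  assumes finite_\<Omega>: "finite \<Omega>"
    and subgroup_S: "x \<in> \<Omega> \<Longrightarrow> subgroup (S x) G"
    and card_S: "x \<in> \<Omega> \<Longrightarrow> card (S x) = h"
    and h_pos: "0 < h"
    and faithful: "(\<Inter>x\<in>\<Omega>. S x) \<subseteq> {\<one>}"
    and regular: "x \<in> \<Omega> \<Longrightarrow> card {y \<in> \<Omega>. 2 * card (S x \<inter> S y) < h} = D"
    and D_bound: "6 * D < card \<Omega>"
begin

definition far :: "'b \<Rightarrow> 'b set"
  where "far x = {y \<in> \<Omega>. 2 * card (S x \<inter> S y) < h}"

lemma card_far: "x \<in> \<Omega> \<Longrightarrow> card (far x) = D"
  by (simp add: far_def regular)

lemma far_subset: "far x \<subseteq> \<Omega>"
  by (auto simp: far_def)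

lemma finite_far: "finite (far x)"
  using far_subset finite_\<Omega> finite_subset by blast

lemma far_sym: "x \<in> \<Omega> \<Longrightarrow> y \<in> far x \<Longrightarrow> x \<in> far y"
  by (auto simp: far_def Int_commute)

lemma finite_S: "x \<in> \<Omega> \<Longrightarrow> finite (S x)"
  using card_S h_pos card_ge_0_finite by metis

lemma one_in_S: "x \<in> \<Omega> \<Longrightarrow> \<one> \<in> S x"
  using subgroup_S subgroup.one_closed by blast

lemma subgroup_S_Int: "x \<in> \<Omega> \<Longrightarrow> y \<in> \<Omega> \<Longrightarrow> subgroup (S x \<inter> S y) G"
  using subgroup_S subgroups_Inter_pair by blast

definition near_both :: "'b \<Rightarrow> 'b \<Rightarrow> 'b set"
  where "near_both x y = \<Omega> - (far x \<union> far y)"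

lemma near_both_commute: "near_both x y = near_both y x"
  by (auto simp: near_both_def)

lemma near_bothD:
  assumes "x \<in> \<Omega>" "y \<in> \<Omega>" "z \<in> near_both x y"
  shows "z \<in> \<Omega>" "h \<le> 2 * card (S z \<inter> S x)" "h \<le> 2 * card (S z \<inter> S y)"
  using assms by (auto simp: near_both_def far_def Int_commute)

lemma card_near_both:
  assumes "x \<in> \<Omega>" "y \<in> \<Omega>"
  shows "4 * D < card (near_both x y)"
proof -
  have "card (far x \<union> far y) \<le> 2 * D"
    using card_Un_le[of "far x" "far y"] card_far assms by simp
  moreover have "card (near_both x y) = card \<Omega> - card (far x \<union> far y)"
    unfolding near_both_def using finite_far far_subset by (simp add: card_Diff_subset)
  ultimately show ?thesis
    using D_bound by linarith
qed

text \<open>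
  The intersection \<open>C\<close> of the two subgroups \<open>S z \<inter> S x\<close> and \<open>S z \<inter> S y\<close>, of index at most two in
  \<open>S z\<close>, has order at least \<open>h / 4\<close>, and it lies in \<open>S x \<inter> S y\<close>, whose order is below \<open>h / 2\<close>. By
  Lagrange there is no room between them, and then all indices involved are forced.
\<close>
lemma far_Int_via_near_both:
  assumes "x \<in> \<Omega>" "y \<in> far x" "z \<in> near_both x y"
  shows "S x \<inter> S y = (S z \<inter> S x) \<inter> (S z \<inter> S y)"
    and "4 * card (S x \<inter> S y) = h"
    and "2 * card (S z \<inter> S x) = h"
proof -
  have y: "y \<in> \<Omega>" "2 * card (S x \<inter> S y) < h"
    using assms by (auto simp: far_def)
  note z = near_bothD[OF assms(1) y(1) assms(3)]
  let ?P = "S x \<inter> S y" and ?U = "S z \<inter> S x" and ?V = "S z \<inter> S y"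
  let ?C = "?U \<inter> ?V"
  have sub: "subgroup ?P G" "subgroup ?U G" "subgroup ?V G"
    using assms y z subgroup_S_Int by auto
  then have subC: "subgroup ?C G"
    using subgroups_Inter_pair by blast
  have finP: "finite ?P"
    using assms finite_S by blast
  have "card ?U * card ?V \<le> h * card ?C"
    using card_mult_le_card_Int[OF sub(2,3) subgroup_S[OF z(1)]] card_S finite_S z(1) by auto
  moreover have "h * h \<le> (2 * card ?U) * (2 * card ?V)"
    using z by (intro mult_mono) auto
  ultimately have "h * h \<le> h * (4 * card ?C)"
    by linarith
  then have hC: "h \<le> 4 * card ?C"
    using h_pos mult_le_cancel1 by blast
  have "card ?C dvd card ?P"
    using subgroup_card_dvd[OF subC sub(1)] by blast
  then obtain q where q: "card ?P = card ?C * q"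
    by blast
  have "0 < card ?P"
    using finP one_in_S assms(1) y(1) card_gt_0_iff by blast
  moreover have "q < 2"
  proof (rule ccontr)
    assume "\<not> q < 2"
    then have "card ?C * 2 \<le> card ?P" unfolding q by simp
    then show False using hC y by simp
  qed
  ultimately have "q = 1"
    using q by (cases q) auto
  then have "card ?C = card ?P"
    using q by simp
  then show CP: "?P = ?C"
    using card_subset_eq[OF finP, of ?C] by blast
  have "card ?U dvd h"
    using subgroup_card_dvd[OF sub(2) subgroup_S[OF z(1)]] card_S z(1) by auto
  then obtain s where s: "h = card ?U * s"
    by blast
  \<comment> \<open>If \<open>S z \<subseteq> S x\<close>, then \<open>S x \<inter> S y = S z \<inter> S y\<close> would be too large.\<close>
  have "s \<noteq> 1"
  proof
    assume "s = 1"
    then have "?U = S z"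
      using card_subset_eq[OF finite_S[OF z(1)], of ?U] s card_S[OF z(1)] by auto
    then have "?V = ?P"
      using CP by blast
    then show False using z y by simp
  qed
  moreover have "s \<noteq> 0"
    using s h_pos by (metis mult_0_right less_irrefl)
  moreover have "s \<le> 2"
  proof (rule ccontr)
    assume "\<not> s \<le> 2"
    then have "card ?U * 3 \<le> h" unfolding s by simp
    then show False using z h_pos by linarith
  qed
  ultimately have "s = 2" by linarith
  then show U: "2 * card ?U = h"
    using s by simp
  have "card ?P dvd card ?U"
    using subgroup_card_dvd[OF sub(1,2)] CP by blast
  then obtain r where r: "card ?U = card ?P * r"
    by blast
  have "r \<noteq> 0" "r \<noteq> 1"
    using r U h_pos y by auto
  then have "card ?P * 2 \<le> card ?U" unfolding r by simp
  then show "4 * card ?P = h"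
    using U hC \<open>card ?C = card ?P\<close> by linarith
qed

text \<open>
  Otherwise the \<open>D\<close> points far from any point outside \<open>B\<close> would all lie in \<open>B\<close>. Since a point of \<open>B\<close>
  is far from only \<open>D\<close> points, \<open>B\<close> would be at least as large as its complement.
\<close>
lemma far_pair_in_majority:
  assumes "B \<subseteq> \<Omega>" "2 * card B < card \<Omega>" "0 < D"
  shows "\<exists>x \<in> \<Omega> - B. \<exists>y \<in> \<Omega> - B. y \<in> far x"
proof (rule ccontr)
  assume no_pair: "\<not> ?thesis"
  have into_B: "far x \<subseteq> B" if "x \<in> \<Omega> - B" for x
    using no_pair that far_subset by blast
  have finB: "finite B"
    using assms finite_\<Omega> finite_subset by blast
  have "{y \<in> B. y \<in> far x} = far x" if "x \<in> \<Omega> - B" for x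
    using into_B[OF that] by blast
  then have "D * card (\<Omega> - B) = (\<Sum>x\<in>\<Omega> - B. card {y \<in> B. y \<in> far x})"
    using card_far by simp
  also have "\<dots> = (\<Sum>y\<in>B. card {x \<in> \<Omega> - B. y \<in> far x})"
    using sum_multicount_gen[of "\<Omega> - B" B "\<lambda>x y. y \<in> far x"] finite_\<Omega> finB by auto
  also have "\<dots> \<le> (\<Sum>y\<in>B. D)"
  proof (rule sum_mono)
    fix y assume "y \<in> B"
    have "{x \<in> \<Omega> - B. y \<in> far x} \<subseteq> far y"
      using far_sym by blast
    then show "card {x \<in> \<Omega> - B. y \<in> far x} \<le> D"
      using card_mono[OF finite_far] card_far \<open>y \<in> B\<close> assms(1) by (metis subsetD)
  qed
  finally have "card (\<Omega> - B) \<le> card B"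
    using \<open>0 < D\<close> by simp
  moreover have "card (\<Omega> - B) = card \<Omega> - card B"
    using assms finB by (simp add: card_Diff_subset)
  ultimately show False
    using assms by linarith
qed

text \<open>
  All intersections of far pairs have the same order \<open>h / 4\<close>, so \<open>S x \<inter> S y\<close> equals \<open>S c \<inter> S e\<close> for
  every far pair \<open>c\<close>, \<open>e\<close> with \<open>S x \<inter> S y \<subseteq> S c\<close> and \<open>S x \<inter> S y \<subseteq> S e\<close>. For any given
  point \<open>d\<close> such a pair can be chosen with neither member far from \<open>d\<close>, which puts \<open>S x \<inter> S y\<close>
  inside \<open>S d\<close>.
\<close>
lemma far_Int_trivial:
  assumes x: "x \<in> \<Omega>" and y: "y \<in> far x"
  shows "S x \<inter> S y = {\<one>}"
proof
  have y\<Omega>: "y \<in> \<Omega>"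
    using y far_subset by blast
  show "{\<one>} \<subseteq> S x \<inter> S y"
    using x y\<Omega> one_in_S by blast
  have D: "0 < D"
    using card_far[OF x] y finite_far card_gt_0_iff by blast
  have "near_both x y \<noteq> {}"
    using card_near_both[OF x y\<Omega>] by auto
  then have card_P: "4 * card (S x \<inter> S y) = h"
    using far_Int_via_near_both(2)[OF x y] by blast
  have "S x \<inter> S y \<subseteq> S d" if d: "d \<in> \<Omega>" for d
  proof -
    let ?M = "{z \<in> \<Omega>. \<not> S x \<inter> S y \<subseteq> S z}"
    have "?M \<subseteq> far x \<union> far y"
      using far_Int_via_near_both(1)[OF x y] by (auto simp: near_both_def)
    then have sub: "?M \<union> far d \<subseteq> far x \<union> far y \<union> far d"
      by blast
    have "card (?M \<union> far d) \<le> card (far x \<union> far y \<union> far d)"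
      using sub finite_far by (meson card_mono finite_UnI)
    also have "\<dots> \<le> 3 * D"
      using card_Un_le[of "far x \<union> far y" "far d"] card_Un_le[of "far x" "far y"]
        card_far[OF x] card_far[OF y\<Omega>] card_far[OF d] by linarith
    finally have "2 * card (?M \<union> far d) < card \<Omega>"
      using D_bound by linarith
    then obtain c e where ce: "c \<in> \<Omega> - (?M \<union> far d)" "e \<in> \<Omega> - (?M \<union> far d)" "e \<in> far c"
      using far_pair_in_majority[of "?M \<union> far d"] D far_subset[of d] by blast
    have dce: "d \<in> near_both c e"
      using ce d far_sym unfolding near_both_def by blast
    have P: "S x \<inter> S y \<subseteq> S c \<inter> S e"
      using ce by blast
    have "card (S c \<inter> S e) = card (S x \<inter> S y)"
      using far_Int_via_near_both(2)[OF _ ce(3) dce] ce card_P by auto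
    then have "S x \<inter> S y = S c \<inter> S e"
      using P ce finite_S by (intro card_subset_eq) auto
    also have "\<dots> \<subseteq> S d"
      using far_Int_via_near_both(1)[OF _ ce(3) dce] ce by blast
    finally show ?thesis .
  qed
  then show "S x \<inter> S y \<subseteq> {\<one>}"
    using faithful by blast
qed

lemma far_order_four:
  assumes x: "x \<in> \<Omega>" and y: "y \<in> far x"
  shows "h = 4"
proof -
  have "near_both x y \<noteq> {}"
    using card_near_both[OF x, of y] y far_subset[of x] by auto
  then have "4 * card (S x \<inter> S y) = h"
    using far_Int_via_near_both(2)[OF x y] by blast
  then show ?thesis
    using far_Int_trivial[OF x y] by simp
qed

lemma card_trace:
  assumes x: "x \<in> \<Omega>" and y: "y \<in> far x" and z: "z \<in> near_both x y"
  shows "card (S z \<inter> S x) = 2" "card (S z \<inter> S y) = 2"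
proof -
  have y\<Omega>: "y \<in> \<Omega>"
    using y far_subset by blast
  show "card (S z \<inter> S x) = 2"
    using far_Int_via_near_both(3)[OF x y z] far_order_four[OF x y] by linarith
  have "z \<in> near_both y x"
    using z near_both_commute by blast
  then show "card (S z \<inter> S y) = 2"
    using far_Int_via_near_both(3)[OF y\<Omega> far_sym[OF x y], of z] far_order_four[OF x y]
    by linarith
qed

text \<open>
  The common traces generate a subgroup of \<open>S z \<inter> S w\<close> of order at least \<open>2 * 2 = h\<close>.
\<close>
lemma traces_determine:
  assumes x: "x \<in> \<Omega>" and y: "y \<in> far x" and z: "z \<in> near_both x y" and w: "w \<in> near_both x y"
    and eq: "S z \<inter> S x = S w \<inter> S x" "S z \<inter> S y = S w \<inter> S y"
  shows "S z = S w"
proof -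
  have y\<Omega>: "y \<in> \<Omega>"
    using y far_subset by blast
  have \<Omega>: "z \<in> \<Omega>" "w \<in> \<Omega>"
    using z w by (auto simp: near_both_def)
  have "card (S z \<inter> S x) * card (S z \<inter> S y)
      \<le> card (S z \<inter> S w) * card ((S z \<inter> S x) \<inter> (S z \<inter> S y))"
    using eq \<Omega> x y\<Omega> subgroup_S_Int finite_S
    by (intro card_mult_le_card_Int) auto
  moreover have "(S z \<inter> S x) \<inter> (S z \<inter> S y) = {\<one>}"
    using far_Int_via_near_both(1)[OF x y z] far_Int_trivial[OF x y] by simp
  then have "card ((S z \<inter> S x) \<inter> (S z \<inter> S y)) = 1"
    by simp
  ultimately have "h \<le> card (S z \<inter> S w)"
    using card_trace[OF x y z] far_order_four[OF x y] by simp
  then show ?thesis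
    using card_S \<Omega> finite_S
    by (metis Int_lower1 Int_lower2 card_seteq)
qed

lemma Int_order_two:
  assumes "card A = 2" "card B = 2" "\<one> \<in> A" "\<one> \<in> B" "A \<noteq> B"
  shows "A \<inter> B = {\<one>}"
  using assms by (auto simp: card_2_iff)

text \<open>
  An element of \<open>S p \<inter> S q\<close> factors through the traces of \<open>p\<close> as well as through those of \<open>q\<close>. Both
  are factorizations over \<open>S x\<close> and \<open>S y\<close>, which meet trivially, so they coincide, and each factor
  lies in two different subgroups of order two.
\<close>
lemma distinct_traces_far:
  assumes x: "x \<in> \<Omega>" and y: "y \<in> far x" and p: "p \<in> near_both x y" and q: "q \<in> near_both x y"
    and ne: "S p \<inter> S x \<noteq> S q \<inter> S x" "S p \<inter> S y \<noteq> S q \<inter> S y"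
  shows "q \<in> far p"
proof -
  have y\<Omega>: "y \<in> \<Omega>"
    using y far_subset by blast
  have \<Omega>: "p \<in> \<Omega>" "q \<in> \<Omega>"
    using p q by (auto simp: near_both_def)
  have factor: "\<exists>u \<in> S z \<inter> S x. \<exists>v \<in> S z \<inter> S y. g = u \<otimes> v"
    if z: "z \<in> near_both x y" and g: "g \<in> S z" for z g
  proof -
    have z\<Omega>: "z \<in> \<Omega>"
      using z by (simp add: near_both_def)
    have "(S z \<inter> S x) \<inter> (S z \<inter> S y) = {\<one>}"
      using far_Int_via_near_both(1)[OF x y z] far_Int_trivial[OF x y] by simp
    moreover have "card (S z \<inter> S x) * card (S z \<inter> S y) = card (S z)"
      using card_trace[OF x y z] far_order_four[OF x y] card_S[OF z\<Omega>] by simp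
    ultimately show ?thesis
      using complement_factorization[of "S z \<inter> S x" "S z \<inter> S y" "S z" g]
        subgroup_S_Int subgroup_S finite_S x y\<Omega> z\<Omega> g by (metis Int_lower1)
  qed
  have triv: "S p \<inter> S x \<inter> (S q \<inter> S x) = {\<one>}" "S p \<inter> S y \<inter> (S q \<inter> S y) = {\<one>}"
    using ne card_trace[OF x y p] card_trace[OF x y q] one_in_S x y\<Omega> \<Omega>
    by (simp_all add: Int_order_two)
  have "g = \<one>" if g: "g \<in> S p" "g \<in> S q" for g
  proof -
    obtain u v where uv: "u \<in> S p \<inter> S x" "v \<in> S p \<inter> S y" "g = u \<otimes> v"
      using factor[OF p g(1)] by blast
    obtain u' v' where uv': "u' \<in> S q \<inter> S x" "v' \<in> S q \<inter> S y" "g = u' \<otimes> v'"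
      using factor[OF q g(2)] by blast
    have "u = u'" "v = v'"
      using factorization_unique[OF subgroup_S[OF x] subgroup_S[OF y\<Omega>] far_Int_trivial[OF x y],
          of u u' v v'] uv uv' by auto
    then have "u = \<one>" "v = \<one>"
      using triv uv uv' by blast+
    then show ?thesis
      using uv by simp
  qed
  then have "S p \<inter> S q = {\<one>}"
    using one_in_S \<Omega> by blast
  then have "2 * card (S p \<inter> S q) < h"
    using far_order_four[OF x y] by simp
  then show ?thesis
    using \<Omega> by (simp add: far_def)
qed

text \<open>
  Whether \<open>e\<close> is far from \<open>d\<close> depends only on \<open>S d\<close>, so a point \<open>e\<close> far from \<open>z\<close> is far from the
  entire set.
\<close>
lemma card_same_subgroup:
  assumes "z \<in> \<Omega>" "0 < D"
  shows "card {d \<in> \<Omega>. S d = S z} \<le> D"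
proof -
  obtain e where e: "e \<in> far z"
    using card_far assms by fastforce
  then have e\<Omega>: "e \<in> \<Omega>"
    using far_subset by blast
  have "{d \<in> \<Omega>. S d = S z} \<subseteq> far e"
    using e by (auto simp: far_def Int_commute)
  then have "card {d \<in> \<Omega>. S d = S z} \<le> card (far e)"
    using finite_far card_mono by blast
  then show ?thesis
    using card_far[OF e\<Omega>] by simp
qed

text \<open>
  With the trace on \<open>S x\<close> fixed, \<open>S d\<close> is determined by its trace on \<open>S y\<close>, which is determined by
  its nontrivial element. As \<open>S y\<close> has order four and the trace of \<open>z\<close> takes up one of the three
  nontrivial elements, two choices remain.
\<close>
lemma card_shared_trace:
  assumes x: "x \<in> \<Omega>" and y: "y \<in> far x" and z: "z \<in> near_both x y"
  shows "card {d \<in> near_both x y. S d \<inter> S x = S z \<inter> S x \<and> S d \<noteq> S z} \<le> 2 * D" (is "card ?R \<le> _")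
proof -
  have y\<Omega>: "y \<in> \<Omega>"
    using y far_subset by blast
  have z\<Omega>: "z \<in> \<Omega>"
    using z by (simp add: near_both_def)
  have D: "0 < D"
    using card_far[OF x] y finite_far card_gt_0_iff by blast
  let ?B = "S y - S z"
  let ?R' = "\<lambda>b. {d \<in> ?R. b \<in> S d}"
  have "card (S y - S z) = card (S y) - card (S y \<inter> S z)"
    using finite_S y\<Omega> by (simp add: card_Diff_subset_Int)
  then have card_B: "card ?B = 2"
    using card_S[OF y\<Omega>] card_trace[OF x y z] far_order_four[OF x y] by (simp add: Int_commute)
  have "?R \<subseteq> (\<Union>b\<in>?B. ?R' b)"
  proof
    fix d assume d: "d \<in> ?R"
    then have "S d \<inter> S y \<noteq> S z \<inter> S y"
      using traces_determine[OF x y _ z] by blast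
    moreover have "card (S d \<inter> S y) = card (S z \<inter> S y)"
      using d card_trace[OF x y] z by simp
    ultimately have "\<not> S d \<inter> S y \<subseteq> S z \<inter> S y"
      using card_subset_eq finite_S z\<Omega> by (metis finite_Int)
    then show "d \<in> (\<Union>b\<in>?B. ?R' b)"
      using d by blast
  qed
  moreover have fin: "finite (?R' b)" for b
    using finite_\<Omega> by (auto simp: near_both_def)
  moreover have "finite ?B"
    using finite_S y\<Omega> by blast
  ultimately have "card ?R \<le> card (\<Union>b\<in>?B. ?R' b)"
    by (intro card_mono) auto
  also have "\<dots> \<le> (\<Sum>b\<in>?B. card (?R' b))"
    using \<open>finite ?B\<close> by (rule card_UN_le)
  also have "\<dots> \<le> (\<Sum>b\<in>?B. D)"
  proof (rule sum_mono)
    fix b assume b: "b \<in> ?B"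
    show "card (?R' b) \<le> D"
    proof (cases "?R' b = {}")
      case False
      then obtain c where c: "c \<in> ?R' b" by blast
      then have c\<Omega>: "c \<in> \<Omega>"
        by (simp add: near_both_def)
      have "S d = S c" if d: "d \<in> ?R' b" for d
      proof (rule traces_determine[OF x y])
        have d\<Omega>: "d \<in> \<Omega>"
          using d by (simp add: near_both_def)
        have "b \<noteq> \<one>"
          using b one_in_S z\<Omega> by blast
        show "S d \<inter> S y = S c \<inter> S y"
        proof (rule ccontr)
          assume "S d \<inter> S y \<noteq> S c \<inter> S y"
          then have "(S d \<inter> S y) \<inter> (S c \<inter> S y) = {\<one>}"
            using c d card_trace[OF x y] one_in_S c\<Omega> d\<Omega> y\<Omega> by (intro Int_order_two) auto
          then show False
            using b c d \<open>b \<noteq> \<one>\<close> by blast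
        qed
      qed (use c d in auto)
      then have "?R' b \<subseteq> {d \<in> \<Omega>. S d = S c}"
        by (auto simp: near_both_def)
      then have "card (?R' b) \<le> card {d \<in> \<Omega>. S d = S c}"
        using finite_\<Omega> by (intro card_mono) auto
      also have "\<dots> \<le> D"
        by (rule card_same_subgroup[OF c\<Omega> D])
      finally show ?thesis .
    next
      case True
      then show ?thesis by (simp only: card.empty)
    qed
  qed
  also have "\<dots> = 2 * D"
    using card_B by simp
  finally show ?thesis .
qed

theorem no_far_pair: "D = 0"
proof (rule ccontr)
  assume "D \<noteq> 0"
  then have D: "0 < D" by simp
  have "\<Omega> \<noteq> {}"
    using D_bound by auto
  then obtain x where x: "x \<in> \<Omega>" by blast
  then obtain y where y: "y \<in> far x"
    using card_far D by fastforce
  then have y\<Omega>: "y \<in> \<Omega>"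
    using far_subset by blast
  have "near_both x y \<noteq> {}"
    using card_near_both[OF x y\<Omega>] by auto
  then obtain z where z: "z \<in> near_both x y" by blast
  then have z\<Omega>: "z \<in> \<Omega>"
    by (simp add: near_both_def)
  \<comment> \<open>the cell of \<open>z\<close>, the rest of its row and the rest of its column\<close>
  let ?E = "{d \<in> \<Omega>. S d = S z}"
  let ?R = "{d \<in> near_both x y. S d \<inter> S x = S z \<inter> S x \<and> S d \<noteq> S z}"
  let ?C = "{d \<in> near_both x y. S d \<inter> S y = S z \<inter> S y \<and> S d \<noteq> S z}"
  have fin: "finite (near_both x y)" "finite ?E" "finite ?R" "finite ?C"
    using finite_\<Omega> by (auto simp: near_both_def)
  have "near_both x y \<subseteq> far z \<union> ?E \<union> ?R \<union> ?C"
    using distinct_traces_far[OF x y z] by (fastforce simp: near_both_def)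
  then have "card (near_both x y) \<le> card (far z \<union> ?E \<union> ?R \<union> ?C)"
    using fin finite_far by (intro card_mono) auto
  also have "\<dots> \<le> card (far z) + card ?E + card ?R + card ?C"
    by (meson add_le_mono card_Un_le le_trans order_refl)
  finally have RC: "2 * D < card ?R + card ?C"
    using card_near_both[OF x y\<Omega>] card_far[OF z\<Omega>] card_same_subgroup[OF z\<Omega> D] by linarith
  have row_col: "q \<in> far p" if p: "p \<in> ?R" and q: "q \<in> ?C" for p q
  proof (rule distinct_traces_far[OF x y])
    show "S p \<inter> S x \<noteq> S q \<inter> S x"
      using traces_determine[OF x y _ z, of q] p q by auto
    show "S p \<inter> S y \<noteq> S q \<inter> S y"
      using traces_determine[OF x y _ z, of p] p q by auto
  qed (use p q in auto)
  have R: "card ?R \<le> D" if q: "q \<in> ?C" for q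
  proof -
    have q\<Omega>: "q \<in> \<Omega>"
      using q by (simp add: near_both_def)
    have "?R \<subseteq> far q"
      using row_col[OF _ q] far_sym by (auto simp: near_both_def)
    then have "card ?R \<le> card (far q)"
      using finite_far card_mono by blast
    then show ?thesis
      using card_far[OF q\<Omega>] by simp
  qed
  have C: "card ?C \<le> D" if p: "p \<in> ?R" for p
  proof -
    have p\<Omega>: "p \<in> \<Omega>"
      using p by (simp add: near_both_def)
    have "?C \<subseteq> far p"
      using row_col[OF p] by blast
    then have "card ?C \<le> card (far p)"
      using finite_far card_mono by blast
    then show ?thesis
      using card_far[OF p\<Omega>] by simp
  qed
  have "card ?R \<le> 2 * D"
    by (rule card_shared_trace[OF x y z])
  moreover have "card ?C \<le> 2 * D"
    using card_shared_trace[OF y\<Omega> far_sym[OF x y], of z] z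
    unfolding near_both_commute[of y x] .
  moreover have "card ?R = 0 \<or> card ?C = 0 \<or> card ?R + card ?C \<le> 2 * D"
  proof (cases "?R = {} \<or> ?C = {}")
    case False
    then obtain p q where "p \<in> ?R" "q \<in> ?C" by blast
    then have "card ?R + card ?C \<le> 2 * D"
      using R[of q] C[of p] by linarith
    then show ?thesis by blast
  next
    case True
    then show ?thesis by (elim disjE) (simp_all only: card.empty simp_thms)
  qed
  ultimately show False
    using RC by linarith
qed

end

section \<open>Point stabilizers of a permutation group\<close>

text \<open>
  Conjugation by \<open>g\<close> maps the stabilizer of \<open>z\<close> into that of \<open>\<phi> g z\<close>. The reverse inequality is the
  instance for \<open>inv g\<close>.
\<close>
lemma (in group_action) card_stabilizer_Int_image_le:
  assumes g: "g \<in> carrier G" and x: "x \<in> E" and y: "y \<in> E" and fin: "finite (carrier G)"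
  shows "card (stabilizer G \<phi> x \<inter> stabilizer G \<phi> y)
    \<le> card (stabilizer G \<phi> (\<phi> g x) \<inter> stabilizer G \<phi> (\<phi> g y))"
proof -
  interpret group G
    using group_hom group_hom.axioms(1) by blast
  let ?c = "\<lambda>k. g \<otimes> k \<otimes> inv g"
  have conj: "?c k \<in> stabilizer G \<phi> (\<phi> g z)" if k: "k \<in> stabilizer G \<phi> z" and z: "z \<in> E" for k z
  proof -
    have kG: "k \<in> carrier G" and kz: "\<phi> k z = z"
      using k by (auto simp: stabilizer_def)
    have "\<phi> (?c k) (\<phi> g z) = \<phi> (g \<otimes> k) (\<phi> (inv g) (\<phi> g z))"
      by (rule composition_rule[OF element_image[OF g z refl]]) (use g kG in auto)
    also have "\<phi> (inv g) (\<phi> g z) = z"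
      using orbit_sym_aux[OF g z] by simp
    also have "\<phi> (g \<otimes> k) z = \<phi> g z"
      using composition_rule[OF z g kG] kz by simp
    finally show ?thesis
      using g kG by (simp add: stabilizer_def)
  qed
  show ?thesis
  proof (rule card_inj_on_le[where f = ?c])
    show "inj_on ?c (stabilizer G \<phi> x \<inter> stabilizer G \<phi> y)"
      using g by (intro inj_onI) (simp add: stabilizer_def)
    show "?c ` (stabilizer G \<phi> x \<inter> stabilizer G \<phi> y)
        \<subseteq> stabilizer G \<phi> (\<phi> g x) \<inter> stabilizer G \<phi> (\<phi> g y)"
      using conj x y by blast
    show "finite (stabilizer G \<phi> (\<phi> g x) \<inter> stabilizer G \<phi> (\<phi> g y))"
      using fin stabilizer_subset by (meson finite_Int finite_subset)
  qed
qed

lemma (in transitive_action) card_stabilizer_eq: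
  assumes "x \<in> E"
  shows "card E * card (stabilizer G \<phi> x) = order G"
proof -
  have "orbit G \<phi> x = E"
    using unique_orbit[OF assms] element_image[OF _ assms] unfolding orbit_def by blast
  then show ?thesis
    using orbit_stabilizer_theorem[OF assms] by simp
qed

text \<open>
  Being far is defined by an inequality of this form. Exchanging \<open>x\<close> and \<open>x'\<close> shows that the number
  of points far from a given point is the same for all points.
\<close>
lemma (in transitive_action) card_small_Int_stabilizers_le:
  assumes fin: "finite (carrier G)" "finite E" and x: "x \<in> E" and x': "x' \<in> E"
  shows "card {y \<in> E. c * card (stabilizer G \<phi> x' \<inter> stabilizer G \<phi> y) < (h :: nat)}
    \<le> card {y \<in> E. c * card (stabilizer G \<phi> x \<inter> stabilizer G \<phi> y) < h}"
proof -
  obtain g where g: "g \<in> carrier G" "\<phi> g x = x'"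
    using unique_orbit[OF x x'] by blast
  let ?g' = "inv g"
  interpret group G
    using group_hom group_hom.axioms(1) by blast
  have g': "?g' \<in> carrier G" "\<phi> ?g' x' = x"
    using g orbit_sym_aux[OF g(1) x] by auto
  show ?thesis
  proof (rule card_inj_on_le[where f = "\<phi> ?g'"])
    show "inj_on (\<phi> ?g') {y \<in> E. c * card (stabilizer G \<phi> x' \<inter> stabilizer G \<phi> y) < h}"
      using inj_prop[OF g'(1)] by (rule inj_on_subset) auto
    show "\<phi> ?g' ` {y \<in> E. c * card (stabilizer G \<phi> x' \<inter> stabilizer G \<phi> y) < h}
        \<subseteq> {y \<in> E. c * card (stabilizer G \<phi> x \<inter> stabilizer G \<phi> y) < h}"
    proof clarify
      fix y assume y: "y \<in> E" "c * card (stabilizer G \<phi> x' \<inter> stabilizer G \<phi> y) < h"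
      have y': "\<phi> ?g' y \<in> E"
        using element_image[OF g'(1) y(1)] by simp
      have "\<phi> g (\<phi> ?g' y) = y"
        using orbit_sym_aux[OF g'(1) y(1)] g by simp
      then have "card (stabilizer G \<phi> x \<inter> stabilizer G \<phi> (\<phi> ?g' y))
          \<le> card (stabilizer G \<phi> x' \<inter> stabilizer G \<phi> y)"
        using card_stabilizer_Int_image_le[OF g(1) x y' fin(1)] g by simp
      then have "c * card (stabilizer G \<phi> x \<inter> stabilizer G \<phi> (\<phi> ?g' y)) < h"
        using y(2) by (meson le_less_trans mult_le_mono2)
      with y' show "\<phi> ?g' y \<in> E \<and> c * card (stabilizer G \<phi> x \<inter> stabilizer G \<phi> (\<phi> ?g' y)) < h"
        by simp
    qed
    show "finite {y \<in> E. c * card (stabilizer G \<phi> x \<inter> stabilizer G \<phi> y) < h}"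
      using fin by simp
  qed
qed

lemma perm_group_action:
  assumes "subgroup H (BijGroup \<Omega>)"
  shows "group_action (perm_group \<Omega> H) \<Omega> (\<lambda>g. g)"
proof -
  have "group (perm_group \<Omega> H)"
    by (rule subgroup.subgroup_is_group[OF assms group_BijGroup])
  moreover have "(\<lambda>g. g) \<in> hom (perm_group \<Omega> H) (BijGroup \<Omega>)"
    using subgroup.subset[OF assms] by (auto simp: hom_def)
  ultimately show ?thesis
    using group_BijGroup
    by (simp add: group_action_def group_hom_def group_hom_axioms_def)
qed

lemma point_stabilizer_action:
  assumes "subgroup G (BijGroup \<Omega>)" and "x \<in> \<Omega>"
  shows "group_action (perm_group \<Omega> (point_stabilizer \<Omega> G x)) \<Omega> (\<lambda>g. g)"
  using group.incl_subgroup[OF group_BijGroup assms(1)]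
    group_action.stabilizer_subgroup[OF perm_group_action[OF assms(1)] assms(2)]
  by (intro perm_group_action) simp

lemma finite_Bij: "finite \<Omega> \<Longrightarrow> finite (Bij \<Omega>)"
  using Bij_imp_extensional Bij_imp_funcset
  by (intro finite_subset[of "Bij \<Omega>" "\<Omega> \<rightarrow>\<^sub>E \<Omega>"] finite_PiE)
     (blast | simp add: PiE_def)+

text \<open>
  This is the link between suborbits and intersections of stabilizers: the orbit-stabilizer theorem
  for the action of the stabilizer of \<open>x\<close>, in which the stabilizer of \<open>y\<close> is the intersection.
\<close>
lemma card_suborbit:
  assumes G: "subgroup G (BijGroup \<Omega>)" and x: "x \<in> \<Omega>" and y: "y \<in> \<Omega>"
  shows "card (orbit (perm_group \<Omega> (point_stabilizer \<Omega> G x)) (\<lambda>g. g) y)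
      * card (point_stabilizer \<Omega> G x \<inter> point_stabilizer \<Omega> G y)
    = card (point_stabilizer \<Omega> G x)"
proof -
  interpret group_action "perm_group \<Omega> (point_stabilizer \<Omega> G x)" \<Omega> "\<lambda>g. g"
    using G x by (rule point_stabilizer_action)
  have "stabilizer (perm_group \<Omega> (point_stabilizer \<Omega> G x)) (\<lambda>g. g) y
      = point_stabilizer \<Omega> G x \<inter> point_stabilizer \<Omega> G y"
    by (auto simp: stabilizer_def)
  then show ?thesis
    using orbit_stabilizer_theorem[OF y] by (simp add: order_def)
qed

theorem theorem1p1:
  fixes \<Omega> :: "'a set" and G :: "('a \<Rightarrow> 'a) set" and \<alpha> :: 'a
  assumes "finite \<Omega>"
    and "subgroup G (BijGroup \<Omega>)"
    and "transitive_action (perm_group \<Omega> G) \<Omega> (\<lambda>g. g)"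
    and "\<alpha> \<in> \<Omega>"
    and "\<^bold>I \<Omega> G \<alpha> > 5 / 6"
  shows "\<^bold>I \<Omega> G \<alpha> = 1 \<and> (\<forall>\<Delta> \<in> suborbits \<Omega> G \<alpha>. card \<Delta> \<le> 2)"
proof -
  interpret A: transitive_action "perm_group \<Omega> G" \<Omega> "\<lambda>g. g"
    by (fact assms(3))
  interpret P: group "perm_group \<Omega> G"
    using A.group_hom group_hom.axioms(1) by blast
  let ?S = "point_stabilizer \<Omega> G"
  let ?orb = "orbit (perm_group \<Omega> (?S \<alpha>)) (\<lambda>g. g)"
  define h where "h = card (?S \<alpha>)"
  define D where "D = card {y \<in> \<Omega>. 2 * card (?S \<alpha> \<inter> ?S y) < h}"
  have G_Bij: "G \<subseteq> Bij \<Omega>"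
    using subgroup.subset[OF assms(2)] by (simp add: BijGroup_def)
  then have finG: "finite G"
    using finite_Bij[OF assms(1)] finite_subset by blast
  have S_fin: "finite (?S x)" for x
    using finG by (simp add: stabilizer_def)
  have one_S: "one (BijGroup \<Omega>) \<in> ?S x" if "x \<in> \<Omega>" for x
    using subgroup.one_closed[OF A.stabilizer_subgroup[OF that]] by simp
  have n: "0 < card \<Omega>"
    using assms(1,4) card_gt_0_iff by blast
  have card_S: "card (?S x) = h" if "x \<in> \<Omega>" for x
    using A.card_stabilizer_eq[OF that] A.card_stabilizer_eq[OF assms(4)] n
    unfolding h_def by (metis mult_left_cancel less_not_refl)
  have card_far: "card {y \<in> \<Omega>. 2 * card (?S x \<inter> ?S y) < h} = D" if "x \<in> \<Omega>" for x
    using A.card_small_Int_stabilizers_le[of \<alpha> x 2 h] A.card_small_Int_stabilizers_le[of x \<alpha> 2 h]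
      finG assms(1,4) that unfolding D_def by (simp add: order_antisym)
  have small: "card (?orb y) \<le> 2 \<longleftrightarrow> \<not> 2 * card (?S \<alpha> \<inter> ?S y) < h" if y: "y \<in> \<Omega>" for y
  proof -
    have "0 < card (?S \<alpha> \<inter> ?S y)"
      using S_fin one_S[OF y] one_S[OF assms(4)] card_gt_0_iff by blast
    then show ?thesis
      using card_suborbit[OF assms(2,4) y] unfolding h_def
      by (metis mult_le_cancel2 not_less)
  qed
  interpret B: group_action "perm_group \<Omega> (?S \<alpha>)" \<Omega> "\<lambda>g. g"
    using assms(2,4) by (rule point_stabilizer_action)
  have orbs: "suborbits \<Omega> G \<alpha> = ?orb ` \<Omega>"
    unfolding suborbits_def orbits_def by blast
  have "(\<exists>\<Delta>\<in>suborbits \<Omega> G \<alpha>. y \<in> \<Delta> \<and> card \<Delta> \<le> 2) \<longleftrightarrow> card (?orb y) \<le> 2" if y: "y \<in> \<Omega>" for y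
  proof -
    have "?orb y \<in> suborbits \<Omega> G \<alpha>" "y \<in> ?orb y"
      using orbs y B.orbit_refl by auto
    moreover have "\<Delta> = ?orb y" if "\<Delta> \<in> suborbits \<Omega> G \<alpha>" "y \<in> \<Delta>" for \<Delta>
      using B.disjoint_union[of \<Delta> "?orb y"] that calculation unfolding suborbits_def by blast
    ultimately show ?thesis by blast
  qed
  then have "{y \<in> \<Omega>. \<exists>\<Delta>\<in>suborbits \<Omega> G \<alpha>. y \<in> \<Delta> \<and> card \<Delta> \<le> 2}
      = \<Omega> - {y \<in> \<Omega>. 2 * card (?S \<alpha> \<inter> ?S y) < h}"
    using small by blast
  then have ratio: "\<^bold>I \<Omega> G \<alpha> = real (card \<Omega> - D) / real (card \<Omega>)"
    using assms(1) by (simp add: small_suborbit_ratio_def D_def card_Diff_subset)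
  have D_le: "D \<le> card \<Omega>"
    unfolding D_def using assms(1) by (intro card_mono) auto
  \<comment> \<open>The proportion is \<open>1 - D / n\<close>, so exceeding \<open>5 / 6\<close> means \<open>D / n < 1 / 6\<close>.\<close>
  have "6 * D < card \<Omega>"
    using assms(5) n D_le unfolding ratio by (simp add: field_simps of_nat_diff)
  moreover have "0 < h"
    unfolding h_def using S_fin one_S[OF assms(4)] card_gt_0_iff by blast
  moreover have "(\<Inter>x\<in>\<Omega>. ?S x) \<subseteq> {one (perm_group \<Omega> G)}"
  proof
    fix g assume "g \<in> (\<Inter>x\<in>\<Omega>. ?S x)"
    then have "g \<in> Bij \<Omega>" "\<And>x. x \<in> \<Omega> \<Longrightarrow> g x = x"
      using G_Bij assms(4) by (auto simp: stabilizer_def)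
    then have "g = (\<lambda>x\<in>\<Omega>. x)"
      by (intro extensionalityI[of _ \<Omega>]) (auto simp: Bij_def)
    then show "g \<in> {one (perm_group \<Omega> G)}"
      by (simp add: BijGroup_def)
  qed
  ultimately interpret F: mostly_close_subgroups "perm_group \<Omega> G" \<Omega> ?S h D
    using P.group_axioms assms(1) A.stabilizer_subgroup card_S card_far
    by (intro mostly_close_subgroups.intro mostly_close_subgroups_axioms.intro)
  have D: "D = 0"
    by (rule F.no_far_pair)
  then have "{y \<in> \<Omega>. 2 * card (?S \<alpha> \<inter> ?S y) < h} = {}"
    unfolding D_def using assms(1) by simp
  then have "\<forall>\<Delta> \<in> suborbits \<Omega> G \<alpha>. card \<Delta> \<le> 2"
    unfolding orbs using small by blast
  moreover have "\<^bold>I \<Omega> G \<alpha> = 1"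
    unfolding ratio D using n by simp
  ultimately show ?thesis by blast
qed

end
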